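(* Fix a prime power $q$, an integer $\ell\ge 2$, and a real number $\varepsilon>0$. There exists $n_0=n_0(q,\ell,\varepsilon)$ such that for all $n>n_0$ and every integer $k$ with $1\le k\le n$ for which $m:=\min\{k,n-k\}$ satisfies $$m\le\frac{\ell}{\ell-1}\log_q n+\log_q(q-1)-\frac{\ell}{\ell-1}\log_q\ell,$$ a uniformly random $k$-dimensional $\mathbb{F}_q$-linear subspace $\mathcal{C}\subseteq\mathbb{F}_q^n$ satisfies $$\Pr[\operatorname{MAut}(\mathcal{C})\ne\operatorname{MAut}_0]\ge\frac12-\varepsilon.$$
   Context: Vectors in $\mathbb{F}_q^n$ are row vectors. The monomial group $M_{n,q}=(\mathbb{F}_q^* )^n\rtimes S_n$ is the group of all $n\times n$ monomial matrices $\mathbf{M}=\mathbf{D}\mathbf{P}$ over $\mathbb{F}_q$, where $\mathbf{D}$ is a diagonal matrix with nonzero diagonal entries and $\mathbf{P}$ is a permutation matrix; it acts on $\mathbb{F}_q^n$ by $\mathbf{x}\mapsto\mathbf{x}\mathbf{M}$. For a linear subspace $\mathcal{C}\subseteq\mathbb{F}_q^n$, put $\mathcal{C}\mathbf{M}=\{\mathbf{c}\mathbf{M}:\mathbf{c}\in\mathcal{C}\}$ and $\operatorname{MAut}(\mathcal{C})=\{\mathbf{M}\in M_{n,q}:\mathcal{C}\mathbf{M}=\mathcal{C}\}$. Let $\operatorname{MAut}_0:=\mathbb{F}_q^*\mathbf{I}_n$ be the group of nonzero scalar matrices, which is contained in $\operatorname{MAut}(\mathcal{C})$ for every $\mathcal{C}$.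 *)

theory Defs
  imports
    "HOL-Probability.Probability_Mass_Function"
    "Jordan_Normal_Form.VS_Connect"
begin

definition vec_mult_mat :: "'a::semiring_0 vec \<Rightarrow> 'a mat \<Rightarrow> 'a vec" (infixl "\<^sub>v*" 70) where
  "x \<^sub>v* M = vec (dim_col M) (\<lambda>j. x \<bullet> col M j)"

definition nonzero_diagonal_matrices :: "nat \<Rightarrow> 'a::field mat set" where
  "nonzero_diagonal_matrices n =
     {D \<in> carrier_mat n n. diagonal_mat D \<and> (\<forall>i<n. D $$ (i, i) \<noteq> 0)}"

definition permutation_matrices :: "nat \<Rightarrow> 'a::field mat set" where
  "permutation_matrices n =
     {mat n n (\<lambda>(i, j). if j = \<sigma> i then 1 else 0) | \<sigma>. \<sigma> permutes {..<n}}"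

definition monomial_group :: "nat \<Rightarrow> 'a::field mat set" where
  "monomial_group n =
     {D * P | D P. D \<in> nonzero_diagonal_matrices n \<and> P \<in> permutation_matrices n}"

definition MAut :: "nat \<Rightarrow> 'a::field vec set \<Rightarrow> 'a mat set" where
  "MAut n C = {M \<in> monomial_group n. (\<lambda>c. c \<^sub>v* M) ` C = C}"

definition MAut0 :: "nat \<Rightarrow> 'a::field mat set" where
  "MAut0 n = {a \<cdot>\<^sub>m 1\<^sub>m n | a. a \<noteq> 0}"

(* The record update is what the locale abbreviation vs of vectorspace unfolds to:
   C with the vector space structure inherited from the ambient space. *)
definition linear_codes :: "nat \<Rightarrow> nat \<Rightarrow> 'a::field vec set set" where
  "linear_codes n k =
     {C. VectorSpace.subspace class_ring C (module_vec TYPE('a) n) \<and>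
         vectorspace.dim class_ring ((module_vec TYPE('a) n)\<lparr>carrier := C\<rparr>) = k}"

(* Only meaningful if linear_codes n k is finite and nonempty, i.e. over a finite field and
   for k \<le> n. *)
definition random_code :: "nat \<Rightarrow> nat \<Rightarrow> 'a::{field,finite} vec set pmf" where
  "random_code n k = pmf_of_set (linear_codes n k)"

end

theory Submission
  imports Defs
begin

text \<open>For \<open>n \<ge> l\<close> the hypothesis on \<open>m\<close> is strongest for large \<open>l\<close>, and already its case \<open>l = 2\<close>,
  namely \<open>4 q\<^sup>m \<le> n\<^sup>2 (q - 1)\<close>, suffices.  If \<open>C\<close> or its dual contains a vector \<open>e\<^sub>i + c e\<^sub>j\<close> with
  \<open>c \<noteq> 0\<close>, then a suitably scaled transposition of the coordinates \<open>i\<close> and \<open>j\<close> preserves \<open>C\<close>.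
  Passing to the dual if necessary, assume that \<open>C\<close> has codimension \<open>m\<close>.  The number of the
  \<open>(n choose 2) (q - 1)\<close> vectors \<open>e\<^sub>i + c e\<^sub>j\<close> lying in \<open>C\<close> has mean \<open>\<mu> \<ge> 1\<close>, and since any two of
  them are linearly independent, the corresponding events are pairwise negatively correlated.  By
  the second moment method \<open>C\<close> contains one of them with probability at least
  \<open>\<mu> / (1 + \<mu>) \<ge> 1 / 2\<close>.\<close>

unbundle no inner_syntax and no vec_syntax

section \<open>Subspaces as sets of prescribed cardinality\<close>

text \<open>An elementwise form of the library's subspace predicate, so that closure can be used
  without module records; \<open>vec_subspace_iff_subspace\<close> links the two.\<close>

definition vec_subspace :: "nat \<Rightarrow> 'a::field vec set \<Rightarrow> bool" where
  "vec_subspace n C \<longleftrightarrow> C \<subseteq> carrier_vec n \<and> 0\<^sub>v n \<in> C \<and>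
     (\<forall>x\<in>C. \<forall>y\<in>C. x + y \<in> C) \<and> (\<forall>a. \<forall>x\<in>C. a \<cdot>\<^sub>v x \<in> C)"

lemma vec_subspaceD:
  assumes "vec_subspace n C"
  shows "C \<subseteq> carrier_vec n" "0\<^sub>v n \<in> C"
    "\<And>x y. x \<in> C \<Longrightarrow> y \<in> C \<Longrightarrow> x + y \<in> C" "\<And>a x. x \<in> C \<Longrightarrow> a \<cdot>\<^sub>v x \<in> C"
  using assms by (auto simp: vec_subspace_def)

lemma vec_subspace_iff_subspace:
  "vec_subspace n C \<longleftrightarrow> VectorSpace.subspace class_ring C (module_vec TYPE('a::field) n)"
  using vec_vs[of n, where 'a='a] vec_module[of n, where 'a='a]
  by (auto simp: vec_subspace_def VectorSpace.subspace_def submodule_def module_vec_simps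
      class_ring_simps)

text \<open>The finite carrier spans itself, so a finite basis exists, and coordinates with respect
  to it give a bijection with the functions from the basis to the field.\<close>

lemma (in vectorspace) card_carrier_eq_power_dim:
  assumes "finite (carrier K)" "finite (carrier V)"
  shows "card (carrier V) = card (carrier K) ^ dim"
proof -
  have "gen_set (carrier V)"
    by (metis in_own_span span_is_subset2 subset_refl subset_antisym)
  then have "fin_dim"
    using assms unfolding fin_dim_def by blast
  then obtain B where B: "finite B" "basis B"
    using finite_basis_exists by blast
  then have sub: "B \<subseteq> carrier V" by (simp add: basis_def)
  from B basis_criterion[OF B(1) sub]
  have ex1: "\<And>v. v \<in> carrier V \<Longrightarrow> \<exists>!a. a \<in> B \<rightarrow>\<^sub>E carrier K \<and> lincomb a B = v" by blast
  have "bij_betw (\<lambda>a. lincomb a B) (B \<rightarrow>\<^sub>E carrier K) (carrier V)"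
    unfolding bij_betw_def
  proof
    have cl: "lincomb a B \<in> carrier V" if "a \<in> B \<rightarrow>\<^sub>E carrier K" for a
      using that sub by (intro lincomb_closed) auto
    then show "inj_on (\<lambda>a. lincomb a B) (B \<rightarrow>\<^sub>E carrier K)"
      using ex1 by (intro inj_onI) metis
    show "(\<lambda>a. lincomb a B) ` (B \<rightarrow>\<^sub>E carrier K) = carrier V"
      using cl ex1 by (auto simp: image_iff) metis
  qed
  then have "card (carrier V) = card (B \<rightarrow>\<^sub>E carrier K)"
    by (simp add: bij_betw_same_card)
  then show ?thesis
    using B dim_basis[OF B] by (simp add: card_PiE)
qed

lemma finite_carrier_vec: "finite (carrier_vec n :: 'a::finite vec set)"
proof (rule finite_surj)
  show "finite ({..<n} \<rightarrow>\<^sub>E (UNIV :: 'a set))"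
    by (intro finite_PiE) auto
  show "carrier_vec n \<subseteq> vec n ` ({..<n} \<rightarrow>\<^sub>E (UNIV :: 'a set))"
  proof
    fix x :: "'a vec" assume "x \<in> carrier_vec n"
    then have "x = vec n (restrict (($) x) {..<n})" by auto
    then show "x \<in> vec n ` ({..<n} \<rightarrow>\<^sub>E UNIV)"
      by (rule image_eqI[where f = "vec n"]) (simp add: restrict_PiE_iff)
  qed
qed

lemma finite_vec_subspace: "vec_subspace n C \<Longrightarrow> finite (C :: 'a::{field,finite} vec set)"
  using finite_carrier_vec finite_subset vec_subspaceD(1) by blast

lemma card_field_gt_1: "1 < CARD('a::{field,finite})"
  using card_mono[of UNIV "{0, 1 :: 'a}"] by simp

text \<open>Since q > 1, the size q^k determines k. Dimension can thus be replaced by cardinality,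
  and later arguments count elements instead of handling bases.\<close>

lemma linear_codes_eq:
  "linear_codes n k = {C :: 'a::{field,finite} vec set. vec_subspace n C \<and> card C = CARD('a) ^ k}"
proof -
  have "vectorspace.dim class_ring ((module_vec TYPE('a) n)\<lparr>carrier := C\<rparr>) = k \<longleftrightarrow>
      card C = CARD('a) ^ k" if C: "vec_subspace n C" for C :: "'a vec set"
  proof -
    interpret V: vectorspace class_ring "module_vec TYPE('a) n" by (rule vec_vs)
    interpret W: vectorspace class_ring "(module_vec TYPE('a) n)\<lparr>carrier := C\<rparr>"
      using C by (intro V.subspace_is_vs) (simp add: vec_subspace_iff_subspace)
    have "card C = CARD('a) ^ W.dim"
      using W.card_carrier_eq_power_dim finite_vec_subspace[OF C] by simp
    then show ?thesis using card_field_gt_1[where 'a='a] by simp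
  qed
  then show ?thesis
    by (auto simp: linear_codes_def vec_subspace_iff_subspace)
qed

section \<open>Existence of codes of every dimension up to \<open>n\<close>\<close>

lemma vec_subspace_carrier: "vec_subspace n (carrier_vec n)"
  by (auto simp: vec_subspace_def)

lemma vec_subspace_trailing_zeros: "vec_subspace n {x \<in> carrier_vec n. \<forall>i<n. k \<le> i \<longrightarrow> x $ i = 0}"
  by (auto simp: vec_subspace_def)

lemma card_trailing_zeros:
  assumes "k \<le> n"
  shows "card {x :: 'a::{field,finite} vec. x \<in> carrier_vec n \<and> (\<forall>i<n. k \<le> i \<longrightarrow> x $ i = 0)}
    = CARD('a) ^ k" (is "card ?W = _")
proof -
  let ?f = "\<lambda>g. vec n (\<lambda>i. if i < k then g i else 0 :: 'a)"
  have "bij_betw ?f ({..<k} \<rightarrow>\<^sub>E UNIV) ?W"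
  proof (rule bij_betw_byWitness[where f' = "\<lambda>x. restrict (($) x) {..<k}"])
    show "\<forall>g\<in>{..<k} \<rightarrow>\<^sub>E UNIV. restrict (($) (?f g)) {..<k} = g"
    proof (intro ballI ext)
      fix g :: "nat \<Rightarrow> 'a" and i assume "g \<in> {..<k} \<rightarrow>\<^sub>E UNIV"
      then show "restrict (($) (?f g)) {..<k} i = g i"
        using assms PiE_arb[of g "{..<k}" "\<lambda>_. UNIV" i] by (cases "i < k") simp_all
    qed
    show "\<forall>x\<in>?W. ?f (restrict (($) x) {..<k}) = x"
      by (auto intro!: eq_vecI)
    show "?f ` ({..<k} \<rightarrow>\<^sub>E UNIV) \<subseteq> ?W"
      by (rule image_subsetI) simp
    show "(\<lambda>x. restrict (($) x) {..<k}) ` ?W \<subseteq> {..<k} \<rightarrow>\<^sub>E UNIV"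
      by (rule image_subsetI) (simp add: restrict_PiE_iff)
  qed
  then have "card ({..<k} \<rightarrow>\<^sub>E (UNIV :: 'a set)) = card ?W"
    by (rule bij_betw_same_card)
  then show ?thesis
    by (simp add: card_PiE)
qed

lemma card_carrier_vec: "card (carrier_vec n :: 'a::{field,finite} vec set) = CARD('a) ^ n"
proof -
  have "{x :: 'a vec. x \<in> carrier_vec n \<and> (\<forall>i<n. n \<le> i \<longrightarrow> x $ i = 0)} = carrier_vec n" by auto
  with card_trailing_zeros[of n n, where 'a='a] show ?thesis by simp
qed

lemma finite_linear_codes: "finite (linear_codes n k :: 'a::{field,finite} vec set set)"
proof (rule finite_subset)
  show "linear_codes n k \<subseteq> Pow (carrier_vec n :: 'a vec set)"
    by (auto simp: linear_codes_eq dest: vec_subspaceD(1))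
qed (simp add: finite_carrier_vec)

text \<open>Needed for the uniform distribution to make sense; the witness is the code of all
  vectors supported on the first \<open>k\<close> coordinates.\<close>

lemma linear_codes_nonempty:
  assumes "k \<le> n"
  shows "(linear_codes n k :: 'a::{field,finite} vec set set) \<noteq> {}"
proof -
  have "{x \<in> carrier_vec n. \<forall>i<n. k \<le> i \<longrightarrow> x $ i = 0} \<in> (linear_codes n k :: 'a vec set set)"
    unfolding linear_codes_eq
    by (intro CollectI conjI vec_subspace_trailing_zeros card_trailing_zeros assms)
  then show ?thesis by blast
qed

section \<open>Duality\<close>

definition dual_code :: "nat \<Rightarrow> 'a::field vec set \<Rightarrow> 'a vec set" where
  "dual_code n C = {y \<in> carrier_vec n. \<forall>x\<in>C. x \<bullet> y = 0}"

lemma vec_subspace_dual: "C \<subseteq> carrier_vec n \<Longrightarrow> vec_subspace n (dual_code n C)"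
  by (auto simp: vec_subspace_def dual_code_def scalar_prod_add_distrib subset_iff)

text \<open>All fibres of the nonzero functional \<open>x \<bullet> y\<close> on \<open>V\<close>
  are translates of its kernel, so \<open>V\<close> splits into q fibres of equal size.\<close>

lemma card_eq_card_times_card_kernel:
  assumes V: "vec_subspace n V" and y: "y \<in> carrier_vec n" and "x\<^sub>0 \<in> V" "x\<^sub>0 \<bullet> y \<noteq> 0"
  shows "card (V :: 'a::{field,finite} vec set) = CARD('a) * card {x \<in> V. x \<bullet> y = 0}"
proof -
  note V' = vec_subspaceD[OF V]
  have fin: "finite V" using V by (rule finite_vec_subspace)
  \<comment> \<open>Normalised so that adding \<open>a \<cdot>\<^sub>v u\<close> raises the product
    with \<open>y\<close> by exactly \<open>a\<close>.\<close>
  define u where "u = (1 / (x\<^sub>0 \<bullet> y)) \<cdot>\<^sub>v x\<^sub>0"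
  have u: "u \<in> V" "u \<bullet> y = 1"
    using assms V' by (auto simp: u_def)
  have carr: "x \<in> V \<Longrightarrow> x \<in> carrier_vec n" for x using V' by auto
  have shift: "(x + a \<cdot>\<^sub>v u) \<bullet> y = x \<bullet> y + a" if "x \<in> V" for x a
    using carr[OF that] carr[OF u(1)] y u(2)
    by (simp add: add_scalar_prod_distrib[of _ n])
  have cancel: "(x + a \<cdot>\<^sub>v u) + (- a) \<cdot>\<^sub>v u = x" if "x \<in> V" for x a
    using carr[OF that] carr[OF u(1)] by (intro eq_vecI) auto
  have fib: "card {x \<in> V. x \<bullet> y = c} = card {x \<in> V. x \<bullet> y = 0}" for c
  proof (rule bij_betw_same_card,
      rule bij_betw_byWitness[where f = "\<lambda>x. x + (- c) \<cdot>\<^sub>v u" and f' = "\<lambda>x. x + c \<cdot>\<^sub>v u"])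
    show "\<forall>x\<in>{x \<in> V. x \<bullet> y = c}. (x + (- c) \<cdot>\<^sub>v u) + c \<cdot>\<^sub>v u = x"
      using cancel[where a = "- c"] by simp
    show "\<forall>x\<in>{x \<in> V. x \<bullet> y = 0}. (x + c \<cdot>\<^sub>v u) + (- c) \<cdot>\<^sub>v u = x"
      using cancel[where a = c] by simp
    show "(\<lambda>x. x + (- c) \<cdot>\<^sub>v u) ` {x \<in> V. x \<bullet> y = c} \<subseteq> {x \<in> V. x \<bullet> y = 0}"
      using V' u(1) shift[where a = "- c"] by auto
    show "(\<lambda>x. x + c \<cdot>\<^sub>v u) ` {x \<in> V. x \<bullet> y = 0} \<subseteq> {x \<in> V. x \<bullet> y = c}"
      using V' u(1) shift[where a = c] by auto
  qed
  have "(\<Union>c\<in>UNIV. {x \<in> V. x \<bullet> y = c}) = V" by auto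
  then have "card V = (\<Sum>c\<in>UNIV. card {x \<in> V. x \<bullet> y = c})"
    using fin by (subst card_UN_disjoint[symmetric]) auto
  also have "\<dots> = (\<Sum>c\<in>(UNIV :: 'a set). card {x \<in> V. x \<bullet> y = 0})"
    using fib by (rule sum.cong[OF refl])
  finally show ?thesis by simp
qed

text \<open>Double counting of the pairs related by \<open>R\<close>; the tool behind duality, the
  incidence counts and both moments.\<close>

lemma sum_card_swap:
  assumes "finite A" "finite B"
  shows "(\<Sum>a\<in>A. card {b \<in> B. R a b}) = (\<Sum>b\<in>B. card {a \<in> A. R a b})"
proof -
  have "(\<Sum>a\<in>A. card {b \<in> B. R a b}) = (\<Sum>a\<in>A. \<Sum>b\<in>B. if R a b then 1 else 0)"
    using assms by (intro sum.cong) (simp_all add: sum.If_cases Int_def)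
  also have "\<dots> = (\<Sum>b\<in>B. \<Sum>a\<in>A. if R a b then 1 else 0)"
    by (rule sum.swap)
  also have "\<dots> = (\<Sum>b\<in>B. card {a \<in> A. R a b})"
    using assms by (intro sum.cong) (simp_all add: sum.If_cases Int_def)
  finally show ?thesis .
qed

text \<open>Count the pairs \<open>(x, y)\<close> with \<open>x \<in> C\<close> and \<open>x \<bullet> y = 0\<close> in both orders: a nonzero
  functional vanishes on a fraction \<open>1 / q\<close> of the space, the zero functional everywhere.\<close>

lemma card_times_card_dual:
  fixes C :: "'a::{field,finite} vec set"
  assumes C: "vec_subspace n C"
  shows "card C * card (dual_code n C) = CARD('a) ^ n"
proof -
  define q where "q = real CARD('a)"
  let ?F = "carrier_vec n :: 'a vec set"
  let ?D = "dual_code n C"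
  note C' = vec_subspaceD[OF C]
  have q: "q > 1" using card_field_gt_1[where 'a='a] by (simp add: q_def)
  have fin: "finite ?F" "finite C"
    using finite_carrier_vec finite_vec_subspace[OF C] by auto
  have D: "?D \<subseteq> ?F" by (auto simp: dual_code_def)
  \<comment> \<open>Multiplying by \<open>q\<close> avoids division; the conditional term is the
    surplus of the zero functional, which vanishes everywhere.\<close>
  have left: "q * real (card {y \<in> ?F. x \<bullet> y = 0}) = q ^ n + (if x = 0\<^sub>v n then (q - 1) * q ^ n else 0)"
    if x: "x \<in> C" for x
  proof (cases "x = 0\<^sub>v n")
    case True
    then have "{y \<in> ?F. x \<bullet> y = 0} = ?F" by auto
    with True show ?thesis by (simp add: card_carrier_vec q_def algebra_simps)
  next
    case False
    have xF: "x \<in> ?F" using x C' by auto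
    with False obtain i where i: "i < n" "x $ i \<noteq> 0" by (metis carrier_vecD eq_vecI index_zero_vec)
    have comm: "{y \<in> ?F. x \<bullet> y = 0} = {y \<in> ?F. y \<bullet> x = 0}"
      using xF by (auto simp: comm_scalar_prod[of _ n])
    have "unit_vec n i \<bullet> x \<noteq> 0" using i xF by simp
    from card_eq_card_times_card_kernel[OF vec_subspace_carrier xF _ this]
    have "CARD('a) ^ n = CARD('a) * card {y \<in> ?F. y \<bullet> x = 0}"
      by (simp add: card_carrier_vec)
    then have "q ^ n = q * real (card {y \<in> ?F. y \<bullet> x = 0})"
      unfolding q_def by (metis of_nat_mult of_nat_power)
    then show ?thesis using False comm by simp
  qed
  have right: "q * real (card {x \<in> C. x \<bullet> y = 0}) =
      real (card C) + (if y \<in> ?D then (q - 1) * real (card C) else 0)" if y: "y \<in> ?F" for y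
  proof (cases "y \<in> ?D")
    case True
    then have "{x \<in> C. x \<bullet> y = 0} = C" by (auto simp: dual_code_def)
    with True show ?thesis by (simp add: algebra_simps)
  next
    case False
    then obtain x where "x \<in> C" "x \<bullet> y \<noteq> 0" using y by (auto simp: dual_code_def)
    from card_eq_card_times_card_kernel[OF C y this] False
    show ?thesis by (simp add: q_def)
  qed
  have "(\<Sum>x\<in>C. q * real (card {y \<in> ?F. x \<bullet> y = 0})) = (\<Sum>y\<in>?F. q * real (card {x \<in> C. x \<bullet> y = 0}))"
    using arg_cong[OF sum_card_swap[OF fin(2,1), of "\<lambda>x y. x \<bullet> y = 0"], of real]
    by (simp flip: sum_distrib_left)
  also have "(\<Sum>x\<in>C. q * real (card {y \<in> ?F. x \<bullet> y = 0})) = real (card C) * q ^ n + (q - 1) * q ^ n"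
    using left fin C'(2) by (simp add: sum.distrib)
  also have "(\<Sum>y\<in>?F. q * real (card {x \<in> C. x \<bullet> y = 0})) =
      q ^ n * real (card C) + real (card ?D) * ((q - 1) * real (card C))"
    using right fin D by (simp add: sum.distrib sum.If_cases card_carrier_vec Int_absorb1 q_def)
  \<comment> \<open>The mixed term \<open>card C * q ^ n\<close> occurs on both sides and
    cancels.\<close>
  finally have "(q - 1) * q ^ n = (q - 1) * (real (card C) * real (card ?D))"
    by (simp add: algebra_simps)
  then have "q ^ n = real (card C) * real (card ?D)" using q by simp
  then show ?thesis unfolding q_def by (metis of_nat_eq_iff of_nat_mult of_nat_power)
qed

text \<open>One inclusion is clear from symmetry of the product, and the cardinality formula,
  applied to \<open>C\<close> and to its dual, shows that both sides have the same size.\<close>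

lemma dual_dual_code:
  fixes C :: "'a::{field,finite} vec set"
  assumes C: "vec_subspace n C"
  shows "dual_code n (dual_code n C) = C"
proof -
  have D: "vec_subspace n (dual_code n C)"
    using C vec_subspace_dual vec_subspaceD(1) by blast
  have DD: "vec_subspace n (dual_code n (dual_code n C))"
    using D vec_subspace_dual vec_subspaceD(1) by blast
  have "C \<subseteq> dual_code n (dual_code n C)"
    using vec_subspaceD(1)[OF C] by (force simp: dual_code_def comm_scalar_prod[of _ n])
  moreover have "card (dual_code n C) * card C = card (dual_code n C) * card (dual_code n (dual_code n C))"
    using card_times_card_dual[OF C] card_times_card_dual[OF D] by (simp add: mult.commute)
  then have "card C = card (dual_code n (dual_code n C))"
    using card_times_card_dual[OF C] card_field_gt_1[where 'a='a] by (metis mult_cancel1 mult_zero_right power_not_zero not_one_less_zero)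
  ultimately show ?thesis
    using finite_vec_subspace[OF DD] card_subset_eq by metis
qed

lemma dual_in_linear_codes:
  assumes C: "C \<in> linear_codes n k" and k: "k \<le> n"
  shows "dual_code n (C :: 'a::{field,finite} vec set) \<in> linear_codes n (n - k)"
proof -
  have "vec_subspace n C" and card: "card C = CARD('a) ^ k"
    using C by (auto simp: linear_codes_eq)
  then have "vec_subspace n (dual_code n C)"
    using vec_subspace_dual vec_subspaceD(1) by blast
  moreover have "CARD('a) ^ k * card (dual_code n C) = CARD('a) ^ k * CARD('a) ^ (n - k)"
    using card_times_card_dual[OF \<open>vec_subspace n C\<close>] card k by (simp flip: power_add)
  ultimately show ?thesis
    by (simp add: linear_codes_eq)
qed

text \<open>Duality is an involution, so counts of codes can be transferred between dimensions
  \<open>k\<close> and \<open>n - k\<close>.\<close>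

lemma bij_betw_dual_linear_codes:
  assumes "k \<le> n"
  shows "bij_betw (dual_code n) (linear_codes n k :: 'a::{field,finite} vec set set) (linear_codes n (n - k))"
  using assms dual_in_linear_codes[of _ n k] dual_in_linear_codes[of _ n "n - k"]
  by (intro bij_betw_byWitness[where f' = "dual_code n"])
    (auto simp: linear_codes_eq dual_dual_code)

section \<open>Counting codes through prescribed vectors\<close>

text \<open>Linearity is demanded on \<open>carrier_vec n\<close> only, because the type contains
  vectors of all lengths.\<close>

definition vec_linear :: "nat \<Rightarrow> ('a::field vec \<Rightarrow> 'a vec) \<Rightarrow> bool" where
  "vec_linear n T \<longleftrightarrow> T \<in> carrier_vec n \<rightarrow> carrier_vec n \<and>
     (\<forall>x\<in>carrier_vec n. \<forall>y\<in>carrier_vec n. T (x + y) = T x + T y) \<and>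
     (\<forall>a. \<forall>x\<in>carrier_vec n. T (a \<cdot>\<^sub>v x) = a \<cdot>\<^sub>v T x)"

lemma vec_linear_zero:
  fixes T :: "'a::field vec \<Rightarrow> 'a vec"
  assumes "vec_linear n T"
  shows "T (0\<^sub>v n) = 0\<^sub>v n"
proof -
  have zero: "0 \<cdot>\<^sub>v x = 0\<^sub>v n" if "x \<in> carrier_vec n" for x :: "'a vec"
    using that by (intro eq_vecI) auto
  have "T (0 \<cdot>\<^sub>v 0\<^sub>v n) = 0 \<cdot>\<^sub>v T (0\<^sub>v n)" "T (0\<^sub>v n) \<in> carrier_vec n"
    using assms by (auto simp: vec_linear_def)
  then show ?thesis using zero by simp
qed

lemma image_in_linear_codes:
  fixes C :: "'a::{field,finite} vec set"
  assumes T: "vec_linear n T" "inj_on T (carrier_vec n)" and C: "C \<in> linear_codes n k"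
  shows "T ` C \<in> linear_codes n k"
proof -
  have sub: "vec_subspace n C" and card: "card C = CARD('a) ^ k"
    using C by (auto simp: linear_codes_eq)
  note C' = vec_subspaceD[OF sub]
  have "card (T ` C) = card C"
    using T(2) C'(1) by (meson card_image inj_on_subset)
  moreover have "vec_subspace n (T ` C)"
    unfolding vec_subspace_def
  proof (intro conjI ballI allI)
    show "T ` C \<subseteq> carrier_vec n" using T C'(1) by (auto simp: vec_linear_def)
    show "0\<^sub>v n \<in> T ` C" using vec_linear_zero[OF T(1)] C'(2) by (metis imageI)
  next
    fix u v assume "u \<in> T ` C" "v \<in> T ` C"
    then obtain x y where xy: "x \<in> C" "y \<in> C" "u = T x" "v = T y" by blast
    then have "u + v = T (x + y)" using T(1) C'(1) by (auto simp: vec_linear_def subset_iff)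
    then show "u + v \<in> T ` C" using C'(3) xy by blast
  next
    fix a u assume "u \<in> T ` C"
    then obtain x where x: "x \<in> C" "u = T x" by blast
    then have "a \<cdot>\<^sub>v u = T (a \<cdot>\<^sub>v x)" using T(1) C'(1) by (auto simp: vec_linear_def subset_iff)
    then show "a \<cdot>\<^sub>v u \<in> T ` C" using C'(4) x by blast
  qed
  ultimately show ?thesis using card by (simp add: linear_codes_eq)
qed

text \<open>Taking images under \<open>T\<close> is an injection between the two families. An
  inequality is enough: equality of counts comes later from using it in both directions.\<close>

lemma card_linear_codes_containing_mono:
  fixes S :: "'a::{field,finite} vec set"
  assumes T: "vec_linear n T" "inj_on T (carrier_vec n)"
  shows "card {C \<in> linear_codes n k. S \<subseteq> C} \<le> card {C \<in> linear_codes n k. T ` S \<subseteq> C}"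
proof (rule card_inj_on_le[where f = "image T"])
  show "inj_on (image T) {C \<in> linear_codes n k. S \<subseteq> C}"
  proof (rule inj_onI)
    fix C D assume "C \<in> {C \<in> linear_codes n k. S \<subseteq> C}" "D \<in> {C \<in> linear_codes n k. S \<subseteq> C}"
      and eq: "T ` C = T ` D"
    then have "C \<subseteq> carrier_vec n" "D \<subseteq> carrier_vec n"
      by (auto simp: linear_codes_eq dest: vec_subspaceD(1))
    with T(2) eq show "C = D" by (simp add: inj_on_image_eq_iff)
  qed
  show "image T ` {C \<in> linear_codes n k. S \<subseteq> C} \<subseteq> {C \<in> linear_codes n k. T ` S \<subseteq> C}"
    using image_in_linear_codes[OF T] by (auto simp: image_mono)
  show "finite {C \<in> linear_codes n k. T ` S \<subseteq> C}"
    using finite_linear_codes by (rule finite_subset[rotated]) auto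
qed

text \<open>Biduality yields \<open>f\<close> nonzero at \<open>w\<close> and \<open>g\<close>
  nonzero at \<open>w'\<close>. If neither is nonzero at both vectors, then \<open>f + g\<close> is;
  scaling makes the value at \<open>w\<close> equal to 1.\<close>

lemma exists_functional:
  fixes U :: "'a::{field,finite} vec set"
  assumes U: "vec_subspace n U" and w: "w \<in> carrier_vec n" "w \<notin> U" and w': "w' \<in> carrier_vec n" "w' \<notin> U"
  obtains f where "f \<in> dual_code n U" "w \<bullet> f = 1" "w' \<bullet> f \<noteq> 0"
proof -
  have D: "vec_subspace n (dual_code n U)"
    using U vec_subspace_dual vec_subspaceD(1) by blast
  note D' = vec_subspaceD[OF D]
  have Dc: "f \<in> dual_code n U \<Longrightarrow> f \<in> carrier_vec n" for f using D' by auto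
  have sep: "\<exists>f\<in>dual_code n U. v \<bullet> f \<noteq> 0" if v: "v \<in> carrier_vec n" "v \<notin> U" for v
  proof -
    have "v \<notin> dual_code n (dual_code n U)" using v dual_dual_code[OF U] by simp
    then obtain f where "f \<in> dual_code n U" "f \<bullet> v \<noteq> 0"
      using v unfolding dual_code_def[of n "dual_code n U"] by blast
    then show ?thesis using v Dc by (metis comm_scalar_prod)
  qed
  obtain f where f: "f \<in> dual_code n U" "w \<bullet> f \<noteq> 0" using sep[OF w] by blast
  obtain g where g: "g \<in> dual_code n U" "w' \<bullet> g \<noteq> 0" using sep[OF w'] by blast
  have add: "v \<bullet> (f + g) = v \<bullet> f + v \<bullet> g" if "v \<in> carrier_vec n" for v
    using that f g Dc by (simp add: scalar_prod_add_distrib[of _ n])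
  have "\<exists>h\<in>dual_code n U. w \<bullet> h \<noteq> 0 \<and> w' \<bullet> h \<noteq> 0"
  proof (cases "w' \<bullet> f = 0 \<and> w \<bullet> g = 0")
    case True
    then show ?thesis using f g add w w' D'(3)[OF f(1) g(1)] by (intro bexI[of _ "f + g"]) auto
  qed (use f g in auto)
  then obtain h where h: "h \<in> dual_code n U" "w \<bullet> h \<noteq> 0" "w' \<bullet> h \<noteq> 0" by blast
  show ?thesis
  proof (rule that)
    show "(1 / (w \<bullet> h)) \<cdot>\<^sub>v h \<in> dual_code n U" using D'(4) h by blast
    show "w \<bullet> ((1 / (w \<bullet> h)) \<cdot>\<^sub>v h) = 1" "w' \<bullet> ((1 / (w \<bullet> h)) \<cdot>\<^sub>v h) \<noteq> 0"
      using h w w' Dc[OF h(1)] by (simp_all add: scalar_prod_smult_distrib[of _ n])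
  qed
qed

text \<open>The map is \<open>x \<mapsto> x + (x \<bullet> f) (w' - w)\<close> for a functional \<open>f\<close> vanishing on \<open>U\<close> with
  \<open>w \<bullet> f = 1\<close>; it is injective because \<open>1 + (w' - w) \<bullet> f = w' \<bullet> f \<noteq> 0\<close>.\<close>

lemma exists_linear_map_fixing:
  fixes U :: "'a::{field,finite} vec set"
  assumes U: "vec_subspace n U" and w: "w \<in> carrier_vec n" "w \<notin> U" and w': "w' \<in> carrier_vec n" "w' \<notin> U"
  obtains T where "vec_linear n T" "inj_on T (carrier_vec n)" "T w = w'" "\<And>u. u \<in> U \<Longrightarrow> T u = u"
proof -
  obtain f where f: "f \<in> dual_code n U" "w \<bullet> f = 1" "w' \<bullet> f \<noteq> 0"
    using exists_functional[OF assms] .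
  have fc: "f \<in> carrier_vec n" using f(1) by (simp add: dual_code_def)
  define T where "T = (\<lambda>x. x + (x \<bullet> f) \<cdot>\<^sub>v (w' - w))"
  \<comment> \<open>\<open>T\<close> multiplies the functional by a nonzero scalar, so
    \<open>T x\<close> determines \<open>x \<bullet> f\<close> and with it \<open>x\<close>.\<close>
  have Tf: "T x \<bullet> f = (x \<bullet> f) * (w' \<bullet> f)" if "x \<in> carrier_vec n" for x
    using that fc w w' f(2)
    by (simp add: T_def add_scalar_prod_distrib[of _ n] minus_scalar_prod_distrib[of _ n] algebra_simps)
  show ?thesis
  proof (rule that)
    show "vec_linear n T"
      unfolding vec_linear_def
    proof (intro conjI ballI allI)
      show "T \<in> carrier_vec n \<rightarrow> carrier_vec n" using w w' by (auto simp: T_def)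
    next
      fix x y :: "'a vec" assume "x \<in> carrier_vec n" "y \<in> carrier_vec n"
      then show "T (x + y) = T x + T y"
        using w w' fc by (intro eq_vecI) (auto simp: T_def add_scalar_prod_distrib[of _ n] algebra_simps)
    next
      fix a and x :: "'a vec" assume "x \<in> carrier_vec n"
      then show "T (a \<cdot>\<^sub>v x) = a \<cdot>\<^sub>v T x"
        using w w' fc by (intro eq_vecI) (auto simp: T_def algebra_simps)
    qed
    show "inj_on T (carrier_vec n)"
    proof (rule inj_onI)
      fix x y assume xy: "x \<in> carrier_vec n" "y \<in> carrier_vec n" "T x = T y"
      then have "x \<bullet> f = y \<bullet> f" using Tf[of x] Tf[of y] f(3) by simp
      with xy have eq: "x + (y \<bullet> f) \<cdot>\<^sub>v (w' - w) = y + (y \<bullet> f) \<cdot>\<^sub>v (w' - w)" by (simp add: T_def)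
      show "x = y"
      proof (rule eq_vecI)
        fix i assume i: "i < dim_vec y"
        from arg_cong[OF eq, of "\<lambda>v. v $ i"] show "x $ i = y $ i"
          using i xy w w' by simp
      qed (use xy in simp)
    qed
    show "T w = w'" using w w' f(2) by (intro eq_vecI) (auto simp: T_def)
    show "T u = u" if "u \<in> U" for u
    proof -
      have "u \<bullet> f = 0" "u \<in> carrier_vec n" using that f(1) vec_subspaceD(1)[OF U] by (auto simp: dual_code_def)
      then show ?thesis using w w' by (intro eq_vecI) (auto simp: T_def)
    qed
  qed
qed

section \<open>Transitivity on nonzero vectors and on independent pairs\<close>

lemma vec_subspace_zero: "vec_subspace n {0\<^sub>v n}"
  by (auto simp: vec_subspace_def)

lemma vec_subspace_line:
  assumes "v \<in> carrier_vec n"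
  shows "vec_subspace n (range (\<lambda>a. a \<cdot>\<^sub>v v))"
  unfolding vec_subspace_def
proof (intro conjI ballI allI)
  have "0\<^sub>v n = 0 \<cdot>\<^sub>v v" using assms by auto
  then show "0\<^sub>v n \<in> range (\<lambda>a. a \<cdot>\<^sub>v v)" by (rule range_eqI)
next
  fix x y assume "x \<in> range (\<lambda>a. a \<cdot>\<^sub>v v)" "y \<in> range (\<lambda>a. a \<cdot>\<^sub>v v)"
  then show "x + y \<in> range (\<lambda>a. a \<cdot>\<^sub>v v)"
    by (auto simp flip: add_smult_distrib_vec)
qed (use assms in \<open>auto simp: smult_smult_assoc\<close>)

lemma card_line:
  fixes v :: "'a::{field,finite} vec"
  assumes v: "v \<in> carrier_vec n" "v \<noteq> 0\<^sub>v n"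
  shows "card (range (\<lambda>a. a \<cdot>\<^sub>v v)) = CARD('a)"
proof (rule card_image, rule injI)
  fix a b assume eq: "a \<cdot>\<^sub>v v = b \<cdot>\<^sub>v v"
  obtain i where "i < n" "v $ i \<noteq> 0" using v by (metis carrier_vecD eq_vecI index_zero_vec)
  then show "a = b" using arg_cong[OF eq, of "\<lambda>u. u $ i"] v by simp
qed

lemma card_linear_codes_point_le:
  fixes v v' :: "'a::{field,finite} vec"
  assumes "v \<in> carrier_vec n" "v \<noteq> 0\<^sub>v n" "v' \<in> carrier_vec n" "v' \<noteq> 0\<^sub>v n"
  shows "card {C \<in> linear_codes n k. v \<in> C} \<le> card {C \<in> linear_codes n k. v' \<in> C}"
proof -
  obtain T where "vec_linear n T" "inj_on T (carrier_vec n)" "T v = v'"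
    using exists_linear_map_fixing[OF vec_subspace_zero] assms by (metis singletonD)
  then show ?thesis
    using card_linear_codes_containing_mono[of n T k "{v}"] by simp
qed

text \<open>Linear independence in an ordered form: first \<open>v\<close>, then \<open>w\<close>
  off its line. This matches both the two-step construction of a linear map and the product count of
  pairs.\<close>

definition indep_pair :: "nat \<Rightarrow> 'a::field vec \<Rightarrow> 'a vec \<Rightarrow> bool" where
  "indep_pair n v w \<longleftrightarrow> v \<in> carrier_vec n \<and> w \<in> carrier_vec n \<and> v \<noteq> 0\<^sub>v n \<and>
     w \<notin> range (\<lambda>a. a \<cdot>\<^sub>v v)"

text \<open>First \<open>v\<close> is moved to \<open>v'\<close>; a second map fixes the line of
  \<open>v'\<close> and moves the image of \<open>w\<close> to \<open>w'\<close>.\<close>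

lemma card_linear_codes_pair_le:
  fixes v v' :: "'a::{field,finite} vec"
  assumes "indep_pair n v w" "indep_pair n v' w'"
  shows "card {C \<in> linear_codes n k. v \<in> C \<and> w \<in> C} \<le> card {C \<in> linear_codes n k. v' \<in> C \<and> w' \<in> C}"
proof -
  have carr: "v \<in> carrier_vec n" "w \<in> carrier_vec n" "v' \<in> carrier_vec n" "w' \<in> carrier_vec n"
    and nz: "v \<noteq> 0\<^sub>v n" "v' \<noteq> 0\<^sub>v n"
    and w: "w \<notin> range (\<lambda>a. a \<cdot>\<^sub>v v)" and w': "w' \<notin> range (\<lambda>a. a \<cdot>\<^sub>v v')"
    using assms by (auto simp: indep_pair_def)
  obtain T where T: "vec_linear n T" "inj_on T (carrier_vec n)" "T v = v'"
    using exists_linear_map_fixing[OF vec_subspace_zero] carr nz by (metis singletonD)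
  have Tw: "T w \<in> carrier_vec n" "T w \<notin> range (\<lambda>a. a \<cdot>\<^sub>v v')"
  proof -
    show "T w \<in> carrier_vec n" using T(1) carr by (auto simp: vec_linear_def)
    show "T w \<notin> range (\<lambda>a. a \<cdot>\<^sub>v v')"
    proof
      assume "T w \<in> range (\<lambda>a. a \<cdot>\<^sub>v v')"
      then obtain a where "T w = a \<cdot>\<^sub>v v'" by blast
      also have "\<dots> = T (a \<cdot>\<^sub>v v)" using T carr by (simp add: vec_linear_def)
      finally have "w = a \<cdot>\<^sub>v v" using T(2) carr by (simp add: inj_on_eq_iff)
      with w show False by blast
    qed
  qed
  obtain U where U: "vec_linear n U" "inj_on U (carrier_vec n)" "U (T w) = w'"
    "\<And>u. u \<in> range (\<lambda>a. a \<cdot>\<^sub>v v') \<Longrightarrow> U u = u"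
    using exists_linear_map_fixing[OF vec_subspace_line[OF carr(3)] Tw carr(4) w'] by blast
  have "v' = 1 \<cdot>\<^sub>v v'" by simp
  then have "U v' = v'" using U(4) by blast
  then show ?thesis
    using card_linear_codes_containing_mono[OF T(1,2), of k "{v, w}"] T(3)
      card_linear_codes_containing_mono[OF U(1,2), of k "{v', T w}"] U(3) by simp
qed

text \<open>Double counting of incidences between codes and nonzero vectors: by transitivity each
  nonzero vector lies in equally many codes.\<close>

lemma card_linear_codes_point:
  fixes v :: "'a::{field,finite} vec"
  assumes v: "v \<in> carrier_vec n" "v \<noteq> 0\<^sub>v n"
  shows "card (linear_codes n k :: 'a vec set set) * (CARD('a) ^ k - 1) =
    (CARD('a) ^ n - 1) * card {C \<in> linear_codes n k. v \<in> C}"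
proof -
  let ?K = "linear_codes n k :: 'a vec set set" and ?F = "carrier_vec n - {0\<^sub>v n} :: 'a vec set"
  have "(\<Sum>C\<in>?K. card {x \<in> ?F. x \<in> C}) = (\<Sum>x\<in>?F. card {C \<in> ?K. x \<in> C})"
    using finite_linear_codes finite_carrier_vec by (intro sum_card_swap) auto
  also have "(\<Sum>C\<in>?K. card {x \<in> ?F. x \<in> C}) = (\<Sum>C\<in>?K. CARD('a) ^ k - 1)"
  proof (rule sum.cong[OF refl])
    fix C assume C: "C \<in> ?K"
    then have sub: "vec_subspace n C" by (simp add: linear_codes_eq)
    then have "{x \<in> ?F. x \<in> C} = C - {0\<^sub>v n}" using vec_subspaceD(1) by blast
    then show "card {x \<in> ?F. x \<in> C} = CARD('a) ^ k - 1"
      using C vec_subspaceD(2)[OF sub] by (simp add: linear_codes_eq)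
  qed
  also have "(\<Sum>x\<in>?F. card {C \<in> ?K. x \<in> C}) = (\<Sum>x\<in>?F. card {C \<in> ?K. v \<in> C})"
    using v by (intro sum.cong[OF refl] antisym card_linear_codes_point_le) auto
  finally show ?thesis
    by (simp add: card_carrier_vec)
qed

text \<open>For the zero space the second subtraction is truncated, which is harmless because the
  first factor is 0.\<close>

lemma card_indep_pairs:
  assumes W: "vec_subspace n (W :: 'a::{field,finite} vec set)"
  shows "card {(v, w). indep_pair n v w \<and> v \<in> W \<and> w \<in> W} = (card W - 1) * (card W - CARD('a))"
proof -
  note W' = vec_subspaceD[OF W]
  have fin: "finite W" using finite_vec_subspace[OF W] .
  have eq: "{(v, w). indep_pair n v w \<and> v \<in> W \<and> w \<in> W} =
      (SIGMA v:W - {0\<^sub>v n}. W - range (\<lambda>a. a \<cdot>\<^sub>v v))"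
    using W'(1) by (auto simp: indep_pair_def)
  have "card (W - range (\<lambda>a. a \<cdot>\<^sub>v v)) = card W - CARD('a)" if "v \<in> W - {0\<^sub>v n}" for v
  proof -
    have "range (\<lambda>a. a \<cdot>\<^sub>v v) \<subseteq> W" using that W'(4) by blast
    then show ?thesis
      using that W'(1) card_line[of v n] by (auto simp: card_Diff_subset subset_iff)
  qed
  then show ?thesis
    unfolding eq using fin W'(2) by (subst card_SigmaI) auto
qed

text \<open>The same double count, with ordered independent pairs in place of nonzero
  vectors.\<close>

lemma card_linear_codes_pair:
  fixes v w :: "'a::{field,finite} vec"
  assumes vw: "indep_pair n v w"
  shows "card (linear_codes n k :: 'a vec set set) * ((CARD('a) ^ k - 1) * (CARD('a) ^ k - CARD('a))) =
    (CARD('a) ^ n - 1) * (CARD('a) ^ n - CARD('a)) * card {C \<in> linear_codes n k. v \<in> C \<and> w \<in> C}"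
proof -
  let ?K = "linear_codes n k :: 'a vec set set"
  let ?P = "{(x, y). indep_pair n x y} :: ('a vec \<times> 'a vec) set"
  let ?R = "\<lambda>C p. fst p \<in> C \<and> snd p \<in> C"
  have P: "?P = {(x, y). indep_pair n x y \<and> x \<in> carrier_vec n \<and> y \<in> carrier_vec n}"
    by (auto simp: indep_pair_def)
  have fin: "finite ?P"
    by (rule finite_subset[of _ "carrier_vec n \<times> carrier_vec n"])
      (auto simp: indep_pair_def finite_carrier_vec)
  have "(\<Sum>C\<in>?K. card {p \<in> ?P. ?R C p}) = (\<Sum>p\<in>?P. card {C \<in> ?K. ?R C p})"
    using finite_linear_codes fin by (rule sum_card_swap)
  also have "(\<Sum>C\<in>?K. card {p \<in> ?P. ?R C p}) = (\<Sum>C\<in>?K. (CARD('a) ^ k - 1) * (CARD('a) ^ k - CARD('a)))"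
  proof (rule sum.cong[OF refl])
    fix C assume C: "C \<in> ?K"
    have "{p \<in> ?P. ?R C p} = {(x, y). indep_pair n x y \<and> x \<in> C \<and> y \<in> C}" by auto
    then show "card {p \<in> ?P. ?R C p} = (CARD('a) ^ k - 1) * (CARD('a) ^ k - CARD('a))"
      using C card_indep_pairs[of n C] by (simp add: linear_codes_eq)
  qed
  also have "(\<Sum>p\<in>?P. card {C \<in> ?K. ?R C p}) = (\<Sum>p\<in>?P. card {C \<in> ?K. v \<in> C \<and> w \<in> C})"
    using vw by (intro sum.cong[OF refl] antisym) (auto intro!: card_linear_codes_pair_le)
  finally show ?thesis
    using card_indep_pairs[of n "carrier_vec n :: 'a vec set", OF vec_subspace_carrier]
    by (simp add: card_carrier_vec flip: P)
qed

section \<open>The second moment method\<close>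

text \<open>With \<open>X C = card {s \<in> S. s \<in> C}\<close> and any real \<open>t\<close>, the integer \<open>X C\<close> satisfies
  \<open>1 - (1 - t X)^2 \<le> [X > 0]\<close>; summing over \<open>C\<close> with \<open>t = 1 / (1 + \<mu>)\<close>, where \<open>\<mu> \<ge> 1\<close> is the
  mean of \<open>X\<close>, bounds the fraction of \<open>C\<close> with \<open>X C > 0\<close> below by \<open>\<mu> / (1 + \<mu>)\<close>.\<close>

lemma second_moment_half:
  fixes K :: "'b set set"
  assumes fin: "finite K" "finite S"
    and N1: "\<And>s. s \<in> S \<Longrightarrow> card {C \<in> K. s \<in> C} = N1"
    and N2: "\<And>s t. s \<in> S \<Longrightarrow> t \<in> S \<Longrightarrow> s \<noteq> t \<Longrightarrow> card {C \<in> K. s \<in> C \<and> t \<in> C} = N2"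
    and neg: "N2 * card K \<le> N1\<^sup>2" and mean: "card K \<le> card S * N1"
  shows "card K \<le> 2 * card {C \<in> K. \<exists>s\<in>S. s \<in> C}"
proof (cases "card K = 0")
  case False
  define X where "X C = real (card {s \<in> S. s \<in> C})" for C
  define N \<mu> t where "N = real (card K)" and "\<mu> = real (card S) * N1 / N" and "t = 1 / (1 + \<mu>)"
  have N: "N > 0" using False by (simp add: N_def)
  have sumX: "(\<Sum>C\<in>K. X C) = N * \<mu>"
  proof -
    have "(\<Sum>C\<in>K. card {s \<in> S. s \<in> C}) = (\<Sum>s\<in>S. card {C \<in> K. s \<in> C})"
      using fin by (rule sum_card_swap)
    also have "\<dots> = card S * N1" using N1 by simp
    finally show ?thesis using N by (simp add: X_def \<mu>_def flip: of_nat_sum of_nat_mult)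
  qed
  have sumX2: "(\<Sum>C\<in>K. (X C)\<^sup>2) \<le> N * \<mu> + N * \<mu>\<^sup>2"
  proof -
    have "(\<Sum>C\<in>K. (card {s \<in> S. s \<in> C})\<^sup>2) = (\<Sum>C\<in>K. card {p \<in> S \<times> S. fst p \<in> C \<and> snd p \<in> C})"
    proof (rule sum.cong[OF refl])
      fix C
      have "{p \<in> S \<times> S. fst p \<in> C \<and> snd p \<in> C} = {s \<in> S. s \<in> C} \<times> {s \<in> S. s \<in> C}" by auto
      then show "(card {s \<in> S. s \<in> C})\<^sup>2 = card {p \<in> S \<times> S. fst p \<in> C \<and> snd p \<in> C}"
        by (simp add: card_cartesian_product power2_eq_square)
    qed
    also have "\<dots> = (\<Sum>p\<in>S \<times> S. card {C \<in> K. fst p \<in> C \<and> snd p \<in> C})"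
      using fin by (intro sum_card_swap) auto
    also have "\<dots> = (\<Sum>s\<in>S. \<Sum>t\<in>S. card {C \<in> K. s \<in> C \<and> t \<in> C})"
      by (simp add: sum.cartesian_product case_prod_beta)
    \<comment> \<open>The diagonal terms are only bounded: they equal \<open>N1\<close>, and the
      extra \<open>N2\<close> lets the double sum factor.\<close>
    also have "\<dots> \<le> (\<Sum>s\<in>S. \<Sum>t\<in>S. N2 + (if s = t then N1 else 0))"
      using N1 N2 by (intro sum_mono) auto
    also have "\<dots> = (card S)\<^sup>2 * N2 + card S * N1"
      using fin by (simp add: sum.distrib power2_eq_square algebra_simps)
    finally have le: "(\<Sum>C\<in>K. (X C)\<^sup>2) \<le> real ((card S)\<^sup>2 * N2 + card S * N1)"
      unfolding X_def by (simp flip: of_nat_power of_nat_sum del: of_nat_add of_nat_mult)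
    have "real N2 * N \<le> (real N1)\<^sup>2"
      using neg unfolding N_def by (simp flip: of_nat_mult of_nat_power)
    then have "real N2 \<le> (real N1)\<^sup>2 / N" using N by (simp add: field_simps)
    then have "(real (card S))\<^sup>2 * N2 \<le> (real (card S))\<^sup>2 * ((real N1)\<^sup>2 / N)"
      by (rule mult_left_mono) simp
    also have "\<dots> = N * \<mu>\<^sup>2" using N by (simp add: \<mu>_def field_simps power2_eq_square)
    finally show ?thesis using le N by (simp add: \<mu>_def)
  qed
  have \<mu>: "\<mu> \<ge> 1"
    using mean N unfolding \<mu>_def N_def by (simp add: le_divide_eq flip: of_nat_mult)
  then have t: "t * (1 + \<mu>) = 1" by (simp add: t_def)
  \<comment> \<open>The left side is \<open>1 - (1 - t * X C)^2\<close>: at most 1 always, and 0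
    when \<open>X C = 0\<close>.\<close>
  have "2 * t * X C - t\<^sup>2 * (X C)\<^sup>2 \<le> (if \<exists>s\<in>S. s \<in> C then 1 else 0)" for C
  proof (cases "\<exists>s\<in>S. s \<in> C")
    case True
    have "0 \<le> (1 - t * X C)\<^sup>2" by simp
    then show ?thesis using True by (simp add: power2_eq_square algebra_simps)
  next
    case False
    then have "{s \<in> S. s \<in> C} = {}" by auto
    then have "X C = 0" unfolding X_def by (simp only: card.empty of_nat_0)
    then show ?thesis using False by simp
  qed
  then have "(\<Sum>C\<in>K. 2 * t * X C - t\<^sup>2 * (X C)\<^sup>2) \<le> (\<Sum>C\<in>K. if \<exists>s\<in>S. s \<in> C then 1 else 0)"
    by (rule sum_mono)
  also have "\<dots> = real (card {C \<in> K. \<exists>s\<in>S. s \<in> C})"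
    using fin by (simp add: sum.If_cases Int_def)
  finally have "2 * t * (N * \<mu>) - t\<^sup>2 * (\<Sum>C\<in>K. (X C)\<^sup>2) \<le> real (card {C \<in> K. \<exists>s\<in>S. s \<in> C})"
    by (simp add: sum_subtractf sumX flip: sum_distrib_left)
  moreover have "t\<^sup>2 * (\<Sum>C\<in>K. (X C)\<^sup>2) \<le> t\<^sup>2 * (N * \<mu> + N * \<mu>\<^sup>2)"
    using sumX2 by (rule mult_left_mono) simp
  \<comment> \<open>The choice of \<open>t\<close> makes the bound on the quadratic term exactly
    half of the linear term, leaving N \<mu> / (1 + \<mu>).\<close>
  moreover have "t\<^sup>2 * (N * \<mu> + N * \<mu>\<^sup>2) = (t * (1 + \<mu>)) * (t * (N * \<mu>))"
    by (simp add: power2_eq_square algebra_simps)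
  ultimately have "t * (N * \<mu>) \<le> real (card {C \<in> K. \<exists>s\<in>S. s \<in> C})"
    unfolding t by simp
  moreover have "N / 2 \<le> t * (N * \<mu>)"
    using \<mu> N by (simp add: t_def field_simps)
  ultimately show ?thesis by (simp add: N_def)
qed simp

section \<open>Vectors of weight two\<close>

definition pair_vec :: "nat \<Rightarrow> nat \<Rightarrow> nat \<Rightarrow> 'a::field \<Rightarrow> 'a vec" where
  "pair_vec n i j c = vec n (\<lambda>a. if a = i then 1 else if a = j then c else 0)"

text \<open>Leading coefficient 1 selects exactly one vector on each line spanned by a vector of
  weight two, which makes distinct members independent.\<close>

definition pair_vecs :: "nat \<Rightarrow> 'a::field vec set" where
  "pair_vecs n = {pair_vec n i j c | i j c. i < j \<and> j < n \<and> c \<noteq> 0}"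

lemma pair_vec_carrier [simp]: "pair_vec n i j c \<in> carrier_vec n"
  by (simp add: pair_vec_def)

lemma dim_pair_vec [simp]: "dim_vec (pair_vec n i j c) = n"
  by (simp add: pair_vec_def)

lemma pair_vec_index [simp]:
  "a < n \<Longrightarrow> pair_vec n i j c $ a = (if a = i then 1 else if a = j then c else 0)"
  by (simp add: pair_vec_def)

text \<open>Proportional vectors have equal supports, the ordering of the indices matches them up,
  and the leading coefficient 1 forces \<open>b = 1\<close>.\<close>

lemma pair_vec_proportional:
  fixes c d :: "'a::field"
  assumes "i < j" "j < n" "c \<noteq> 0" "i' < j'" "j' < n" "d \<noteq> 0"
    and eq: "pair_vec n i' j' d = b \<cdot>\<^sub>v pair_vec n i j c"
  shows "i' = i \<and> j' = j \<and> d = c"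
proof -
  have idx: "(if a = i' then 1 else if a = j' then d else 0) =
      b * (if a = i then 1 else if a = j then c else 0)" if "a < n" for a
    using arg_cong[OF eq, of "\<lambda>u. u $ a"] that by (simp add: pair_vec_def)
  have b: "b \<noteq> 0" using idx[of i'] assms by auto
  have supp: "a = i' \<or> a = j' \<longleftrightarrow> a = i \<or> a = j" if "a < n" for a
    using idx[OF that] assms b by (auto split: if_splits)
  then have "i' = i \<or> i' = j" "j' = i \<or> j' = j" "i = i' \<or> i = j'" "j = i' \<or> j = j'"
    using supp[of i'] supp[of j'] supp[of i] supp[of j] assms(1,2,4,5) by auto
  then have ij: "i' = i" "j' = j" using assms(1,4) by linarith+
  then have "b = 1" using idx[of i] assms by simp
  then show ?thesis using idx[of j] assms ij by simp
qed

lemma pair_vecs_nonzero: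
  assumes "v \<in> pair_vecs n"
  shows "v \<in> carrier_vec n" "v \<noteq> 0\<^sub>v n"
proof -
  obtain i j c where v: "v = pair_vec n i j c" "i < j" "j < n" using assms by (auto simp: pair_vecs_def)
  then have "v $ i = 1" "i < n" by simp_all
  then show "v \<noteq> 0\<^sub>v n" by auto
  show "v \<in> carrier_vec n" using v by simp
qed

lemma pair_vecs_indep:
  assumes "v \<in> pair_vecs n" "w \<in> pair_vecs n" "v \<noteq> w"
  shows "indep_pair n v w"
proof -
  obtain i j c i' j' d where v: "v = pair_vec n i j c" "i < j" "j < n" "c \<noteq> 0"
    and w: "w = pair_vec n i' j' d" "i' < j'" "j' < n" "d \<noteq> 0"
    using assms by (auto simp: pair_vecs_def)
  have "w \<notin> range (\<lambda>a. a \<cdot>\<^sub>v v)"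
  proof
    assume "w \<in> range (\<lambda>a. a \<cdot>\<^sub>v v)"
    then obtain b where "w = b \<cdot>\<^sub>v v" by (rule rangeE)
    then have "pair_vec n i' j' d = b \<cdot>\<^sub>v pair_vec n i j c" using v w by simp
    from pair_vec_proportional[OF _ _ _ _ _ _ this] show False using v w assms(3) by simp
  qed
  then show ?thesis using pair_vecs_nonzero[OF assms(1)] pair_vecs_nonzero[OF assms(2)] by (simp add: indep_pair_def)
qed

lemma card_pair_vecs:
  "2 * card (pair_vecs n :: 'a::{field,finite} vec set) = n * (n - 1) * (CARD('a) - 1)"
  and finite_pair_vecs: "finite (pair_vecs n :: 'a vec set)"
proof -
  let ?I = "(SIGMA j:{..<n}. {..<j}) \<times> (UNIV - {0 :: 'a})"
  let ?f = "\<lambda>((j, i), c). pair_vec n i j c"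
  have eq: "pair_vecs n = ?f ` ?I"
    by (auto simp: pair_vecs_def image_iff) blast
  have "inj_on ?f ?I"
  proof (rule inj_onI)
    fix p r assume p: "p \<in> ?I" "r \<in> ?I" "?f p = ?f r"
    obtain i j c i' j' d where pr: "p = ((j, i), c)" "r = ((j', i'), d)" by (metis surj_pair)
    have "pair_vec n i' j' d = 1 \<cdot>\<^sub>v pair_vec n i j c" using p(3) pr by simp
    from pair_vec_proportional[OF _ _ _ _ _ _ this] show "p = r"
      using p(1,2) pr by auto
  qed
  then have "card (pair_vecs n :: 'a vec set) = card ?I"
    unfolding eq by (rule card_image)
  also have "\<dots> = (\<Sum>j<n. j) * (CARD('a) - 1)"
    by (simp add: card_cartesian_product card_SigmaI)
  finally have "2 * card (pair_vecs n :: 'a vec set) = (2 * (\<Sum>j<n. j)) * (CARD('a) - 1)"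
    by simp
  also have "2 * (\<Sum>j<n. j) = n * (n - 1)"
    by (induction n) (auto simp: algebra_simps)
  finally show "2 * card (pair_vecs n :: 'a vec set) = n * (n - 1) * (CARD('a) - 1)" .
  show "finite (pair_vecs n :: 'a vec set)"
    unfolding eq by (intro finite_imageI finite_cartesian_product finite_SigmaI) auto
qed

text \<open>The second moment bound with \<open>S = pair_vecs n\<close>. Here
  \<open>n <= 2 * k\<close> ensures \<open>k >= 2\<close>, hence q^k >= 4, and the bound on q^(n -
  k) makes the mean at least 1.\<close>

lemma half_codes_meet_pair_vecs:
  fixes n k :: nat
  defines "q \<equiv> CARD('a::{field,finite})"
  assumes n: "n \<ge> 3" and k: "k \<le> n" "n \<le> 2 * k"
    and bound: "4 * q ^ (n - k) \<le> n\<^sup>2 * (q - 1)"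
  shows "card (linear_codes n k :: 'a vec set set) \<le>
    2 * card {C \<in> linear_codes n k :: 'a vec set set. \<exists>v\<in>pair_vecs n. v \<in> C}"
proof -
  let ?K = "linear_codes n k :: 'a vec set set" and ?S = "pair_vecs n :: 'a vec set"
  have q: "q \<ge> 2" using card_field_gt_1[where 'a='a] by (simp add: q_def)
  have k2: "k \<ge> 2" using n k by simp
  have K: "card ?K > 0"
    using linear_codes_nonempty[OF k(1), where 'a='a] finite_linear_codes by (simp add: card_gt_0_iff)
  define Q P where "Q = real q ^ n" and "P = real q ^ k"
  have rq: "real q \<ge> 2" using q by simp
  have P4: "P \<ge> 4"
  proof -
    have "4 = (2::real) ^ 2" by simp
    also have "\<dots> \<le> 2 ^ k" using k2 by (intro power_increasing) auto
    also have "\<dots> \<le> P" unfolding P_def using rq by (intro power_mono) auto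
    finally show ?thesis .
  qed
  have PQ: "P \<le> Q" unfolding P_def Q_def using rq k by (intro power_increasing) auto
  have qP: "real q \<le> P" "real q < Q"
  proof -
    show "real q \<le> P" unfolding P_def using power_increasing[of 1 k "real q"] k2 rq by simp
    show "real q < Q" unfolding Q_def using power_strict_increasing[of 1 n "real q"] n rq by simp
  qed
  have nat_P: "real (q ^ k - 1) = P - 1" "real (q ^ k - q) = P - q"
    using q k2 self_le_power[of q k] by (simp_all add: P_def of_nat_diff)
  have nat_Q: "real (q ^ n - 1) = Q - 1" "real (q ^ n - q) = Q - q"
    using q n self_le_power[of q n] by (simp_all add: Q_def of_nat_diff)
  define N where "N = real (card ?K)"
  \<comment> \<open>Representatives for defining \<open>N1\<close> and \<open>N2\<close>; the
    witnesses e_0 + e_1 and e_0 + e_2 exist because \<open>n >= 3\<close>.\<close>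
  obtain v w :: "'a vec" where vw: "v \<in> ?S" "w \<in> ?S" "v \<noteq> w"
  proof -
    have "pair_vec n 0 1 (1::'a) \<noteq> pair_vec n 0 2 1"
    proof
      assume eq: "pair_vec n 0 1 (1::'a) = pair_vec n 0 2 1"
      show False using arg_cong[OF eq, of "\<lambda>u. u $ 1"] n by (simp add: pair_vec_def)
    qed
    moreover have "pair_vec n 0 1 (1::'a) \<in> ?S" "pair_vec n 0 2 (1::'a) \<in> ?S"
      unfolding pair_vecs_def using n by force+
    ultimately show ?thesis using that by blast
  qed
  define N1 where "N1 = card {C \<in> ?K. v \<in> C}"
  define N2 where "N2 = card {C \<in> ?K. v \<in> C \<and> w \<in> C}"
  have N1_eq: "N * (P - 1) = (Q - 1) * N1"
    using arg_cong[OF card_linear_codes_point[OF pair_vecs_nonzero[OF vw(1)], of k], of real]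
    by (simp only: of_nat_mult N1_def N_def nat_P nat_Q flip: q_def)
  have N2_eq: "N * ((P - 1) * (P - q)) = (Q - 1) * (Q - q) * N2"
    using arg_cong[OF card_linear_codes_pair[OF pair_vecs_indep[OF vw], of k], of real]
    by (simp only: of_nat_mult N2_def N_def nat_P nat_Q flip: q_def)
  have Q1: "Q - 1 > 0" "Q - q > 0" using qP rq by auto
  show ?thesis
  proof (rule second_moment_half[where ?N1.0 = N1 and ?N2.0 = N2])
    show "card {C \<in> ?K. s \<in> C} = N1" if "s \<in> ?S" for s
      unfolding N1_def
      by (intro antisym card_linear_codes_point_le pair_vecs_nonzero that vw)
    show "card {C \<in> ?K. s \<in> C \<and> t \<in> C} = N2" if "s \<in> ?S" "t \<in> ?S" "s \<noteq> t" for s t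
      unfolding N2_def
      by (intro antisym card_linear_codes_pair_le pair_vecs_indep that vw)
    show "N2 * card ?K \<le> N1\<^sup>2"
    proof -
      have a: "real N1 = N * ((P - 1) / (Q - 1))" using N1_eq Q1 by (simp add: field_simps)
      have b: "real N2 = N * ((P - 1) / (Q - 1)) * ((P - q) / (Q - q))"
      proof -
        have "real N2 = N * ((P - 1) * (P - q)) / ((Q - 1) * (Q - q))"
          unfolding N2_eq using Q1 by simp
        then show ?thesis by simp
      qed
      \<comment> \<open>Negative correlation: given that one vector lies in \<open>C\<close>, an
        independent one is no likelier to. Cross-multiplied, the difference is (q - 1)(Q -
        P).\<close>
      have "(P - q) / (Q - q) \<le> (P - 1) / (Q - 1)"
      proof -
        have "0 \<le> (real q - 1) * (Q - P)" using rq PQ by simp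
        then have "(P - q) * (Q - 1) \<le> (P - 1) * (Q - q)" by (simp add: algebra_simps)
        then show ?thesis using Q1 by (simp add: divide_le_eq le_divide_eq mult.commute)
      qed
      then have "real N2 \<le> N * ((P - 1) / (Q - 1)) * ((P - 1) / (Q - 1))"
        unfolding b using P4 Q1 by (intro mult_left_mono) (auto simp: N_def)
      then have "real N2 * N \<le> N * ((P - 1) / (Q - 1)) * ((P - 1) / (Q - 1)) * N"
        by (rule mult_right_mono) (simp add: N_def)
      also have "\<dots> = (real N1)\<^sup>2" unfolding a by (simp add: power2_eq_square)
      finally have "real (N2 * card ?K) \<le> real (N1\<^sup>2)" by (simp add: N_def)
      then show ?thesis by (simp only: of_nat_le_iff)
    qed
    show "card ?K \<le> card ?S * N1"
    proof -
      have S: "real (card ?S) = real n * (real n - 1) * (real q - 1) / 2"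
        using arg_cong[OF card_pair_vecs[of n, where 'a='a], of real] n q
        by (simp add: q_def of_nat_diff)
      have "real (4 * q ^ (n - k)) \<le> real (n\<^sup>2 * (q - 1))"
        using bound by (simp only: of_nat_le_iff)
      then have bd: "4 * real q ^ (n - k) \<le> (real n)\<^sup>2 * (real q - 1)"
        using q by (simp add: of_nat_diff)
      have split: "Q = real q ^ (n - k) * P"
        unfolding Q_def P_def using k by (simp flip: power_add)
      have "4 * Q \<le> (real n)\<^sup>2 * (real q - 1) * P"
        unfolding split using mult_right_mono[OF bd, of P] P4 by simp
      moreover have "(real n)\<^sup>2 * (real q - 1) * P \<le> 4 * (real (card ?S) * (P - 1))"
      proof -
        \<comment> \<open>Replacing \<open>n\<close> and \<open>P\<close> by \<open>n - 1\<close>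
          and \<open>P - 1\<close> costs at most a factor 2, with equality at n = 3, P = 4. With the
          2 of the binomial coefficient this accounts for the 4 in the hypothesis.\<close>
        have "real n * P \<le> 2 * (real n - 1) * (P - 1)"
        proof -
          have "0 \<le> (real n - 3) * (P - 4)" using n P4 by simp
          moreover have "0 \<le> 2 * (real n - 3) + (P - 4)" using n P4 by simp
          ultimately show ?thesis using n P4 by (simp add: algebra_simps)
        qed
        then have "real n * (real q - 1) * (real n * P) \<le> real n * (real q - 1) * (2 * (real n - 1) * (P - 1))"
          using rq by (intro mult_left_mono) auto
        then show ?thesis by (simp add: S power2_eq_square algebra_simps)
      qed
      ultimately have "Q \<le> card ?S * (P - 1)" by simp
      then have "N * (Q - 1) \<le> N * (card ?S * (P - 1))"
        by (intro mult_left_mono) (auto simp: N_def)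
      also have "\<dots> = (card ?S * N1) * (Q - 1)" using N1_eq by (simp add: mult_ac)
      finally have "N \<le> card ?S * N1" using Q1 by simp
      then show ?thesis unfolding N_def by (simp only: of_nat_le_iff flip: of_nat_mult)
    qed
  qed (use finite_linear_codes finite_pair_vecs in auto)
qed

section \<open>A monomial automorphism from a vector of weight two\<close>

text \<open>On row vectors, entry \<open>i\<close> moves to position \<open>j\<close> times
  \<open>c\<close> and entry \<open>j\<close> to position \<open>i\<close> divided by
  \<open>c\<close>. The reciprocal factors make this an involution for distinct \<open>i\<close>,
  \<open>j\<close> and nonzero \<open>c\<close>.\<close>

definition swap_mat :: "nat \<Rightarrow> nat \<Rightarrow> nat \<Rightarrow> 'a::field \<Rightarrow> 'a mat" where
  "swap_mat n i j c = mat n n (\<lambda>(a, b). if b = Transposition.transpose i j a then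
     (if a = i then c else if a = j then 1 / c else 1) else 0)"

lemma swap_mat_monomial:
  assumes "i < n" "j < n" "c \<noteq> 0"
  shows "swap_mat n i j c \<in> monomial_group n"
proof -
  let ?d = "\<lambda>a. if a = i then c else if a = j then 1 / c else 1"
  let ?D = "mat n n (\<lambda>(a, b). if a = b then ?d a else 0)"
  let ?P = "mat n n (\<lambda>(a, b). if b = Transposition.transpose i j a then 1 else 0) :: 'a mat"
  have "swap_mat n i j c = ?D * ?P"
  proof (rule eq_matI)
    fix a b assume ab: "a < dim_row (?D * ?P)" "b < dim_col (?D * ?P)"
    have "(?D * ?P) $$ (a, b) = (\<Sum>e = 0..<n. (if a = e then ?d a else 0) * (if b = Transposition.transpose i j e then 1 else 0))"
      using ab by (simp add: scalar_prod_def)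
    also have "\<dots> = (\<Sum>e = 0..<n. if a = e then ?d a * (if b = Transposition.transpose i j a then 1 else 0) else 0)"
      by (intro sum.cong) auto
    also have "\<dots> = ?d a * (if b = Transposition.transpose i j a then 1 else 0)"
      using ab by simp
    finally show "swap_mat n i j c $$ (a, b) = (?D * ?P) $$ (a, b)"
      using ab by (simp add: swap_mat_def)
  qed (simp_all add: swap_mat_def)
  moreover have "?D \<in> nonzero_diagonal_matrices n"
    using assms by (auto simp: nonzero_diagonal_matrices_def diagonal_mat_def)
  moreover have "?P \<in> permutation_matrices n"
    unfolding permutation_matrices_def using assms permutes_swap_id[of i "{..<n}" j] by auto
  ultimately show ?thesis unfolding monomial_group_def by blast
qed

lemma swap_mat_not_scalar:
  assumes "i < n" "j < n" "i \<noteq> j" "c \<noteq> 0"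
  shows "swap_mat n i j c \<notin> MAut0 n"
proof
  assume "swap_mat n i j c \<in> MAut0 n"
  then obtain a where "swap_mat n i j c = a \<cdot>\<^sub>m 1\<^sub>m n" by (auto simp: MAut0_def)
  from arg_cong[OF this, of "\<lambda>M. M $$ (i, j)"] show False
    using assms by (simp add: swap_mat_def)
qed

lemma vec_mult_swap_mat:
  assumes x: "x \<in> carrier_vec n" and ij: "i < n" "j < n" "i \<noteq> j"
  shows "x \<^sub>v* swap_mat n i j c =
    vec n (\<lambda>b. if b = i then x $ j / c else if b = j then c * x $ i else x $ b)"
proof (rule eq_vecI)
  fix b assume "b < dim_vec (vec n (\<lambda>b. if b = i then x $ j / c else if b = j then c * x $ i else x $ b))"
  then have b: "b < n" by simp
  let ?d = "\<lambda>a. if a = i then c else if a = j then 1 / c else 1"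
  have "(x \<^sub>v* swap_mat n i j c) $ b = (\<Sum>a = 0..<n. x $ a * (if b = Transposition.transpose i j a then ?d a else 0))"
    using b x by (simp add: vec_mult_mat_def swap_mat_def scalar_prod_def)
  \<comment> \<open>A transposition is its own inverse, so the condition can be solved for
    \<open>a\<close> and one summand survives.\<close>
  also have "\<dots> = (\<Sum>a = 0..<n. if a = Transposition.transpose i j b then x $ a * ?d a else 0)"
    by (intro sum.cong) auto
  also have "\<dots> = x $ Transposition.transpose i j b * ?d (Transposition.transpose i j b)"
    using b ij by (auto simp: Transposition.transpose_def)
  finally show "(x \<^sub>v* swap_mat n i j c) $ b =
      vec n (\<lambda>b. if b = i then x $ j / c else if b = j then c * x $ i else x $ b) $ b"
    using b ij by (auto simp: Transposition.transpose_def)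
qed (simp add: vec_mult_mat_def swap_mat_def)

text \<open>For an involution, mapping \<open>C\<close> into itself already implies mapping it onto
  itself.\<close>

lemma swap_mat_in_MAut:
  assumes C: "C \<subseteq> carrier_vec n" and ij: "i < n" "j < n" "i \<noteq> j" and c: "c \<noteq> 0"
    and stable: "\<And>x. x \<in> C \<Longrightarrow> x \<^sub>v* swap_mat n i j c \<in> C"
  shows "swap_mat n i j c \<in> MAut n C"
proof -
  have "x \<in> (\<lambda>x. x \<^sub>v* swap_mat n i j c) ` C" if x: "x \<in> C" for x
  proof
    show "x \<^sub>v* swap_mat n i j c \<in> C" using stable x .
    have "x \<in> carrier_vec n" "x \<^sub>v* swap_mat n i j c \<in> carrier_vec n" using C x stable by auto
    then show "x = x \<^sub>v* swap_mat n i j c \<^sub>v* swap_mat n i j c"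
      using ij c by (intro eq_vecI) (auto simp: vec_mult_swap_mat)
  qed
  then show ?thesis
    using swap_mat_monomial[OF ij(1,2) c] stable by (auto simp: MAut_def)
qed

text \<open>Along a vector \<open>v = e\<^sub>i + c e\<^sub>j\<close> of \<open>C\<close> the swap changes \<open>x\<close> by a multiple of \<open>v\<close>.\<close>

lemma MAut_neq_MAut0_if_pair_vec:
  assumes C: "vec_subspace n C" and v: "v \<in> pair_vecs n" "v \<in> C"
  shows "MAut n C \<noteq> MAut0 n"
proof -
  note C' = vec_subspaceD[OF C]
  obtain i j c where ij: "v = pair_vec n i j c" "i < j" "j < n" "c \<noteq> 0"
    using v by (auto simp: pair_vecs_def)
  \<comment> \<open>With parameter \<open>- c\<close> the changes in entries \<open>i\<close> and
    \<open>j\<close> are in the ratio 1 : c, as in \<open>v\<close>.\<close>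
  have "swap_mat n i j (- c) \<in> MAut n C"
  proof (rule swap_mat_in_MAut)
    fix x assume x: "x \<in> C"
    then have xc: "x \<in> carrier_vec n" using C' by auto
    have "x \<^sub>v* swap_mat n i j (- c) = x + (- (x $ i + x $ j / c)) \<cdot>\<^sub>v v"
      using xc ij by (intro eq_vecI) (auto simp: vec_mult_swap_mat field_simps)
    then show "x \<^sub>v* swap_mat n i j (- c) \<in> C" using C' x v by simp
  qed (use C' ij in auto)
  moreover have "swap_mat n i j (- c) \<notin> MAut0 n"
    using ij by (intro swap_mat_not_scalar) auto
  ultimately show ?thesis by blast
qed

text \<open>Orthogonality to \<open>v\<close> says that x_i = - c x_j on \<open>C\<close>, so the
  swap with parameter \<open>- 1 / c\<close> fixes every codeword, although it is not a scalar
  matrix.\<close>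

lemma MAut_neq_MAut0_if_dual_pair_vec:
  assumes C: "vec_subspace n C" and v: "v \<in> pair_vecs n" "v \<in> dual_code n C"
  shows "MAut n C \<noteq> MAut0 n"
proof -
  note C' = vec_subspaceD[OF C]
  obtain i j c where ij: "v = pair_vec n i j c" "i < j" "j < n" "c \<noteq> 0"
    using v by (auto simp: pair_vecs_def)
  have "swap_mat n i j (- 1 / c) \<in> MAut n C"
  proof (rule swap_mat_in_MAut)
    fix x assume x: "x \<in> C"
    then have xc: "x \<in> carrier_vec n" using C' by auto
    have "x \<bullet> v = (\<Sum>a = 0..<n. (if a = i then x $ i else 0) + (if a = j then c * x $ j else 0))"
      unfolding scalar_prod_def using ij by (intro sum.cong) (auto simp: pair_vec_def)
    also have "\<dots> = x $ i + c * x $ j" using ij by (simp add: sum.distrib)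
    finally have "x $ i + c * x $ j = 0" using v x by (simp add: dual_code_def)
    then have "x $ i = - (c * x $ j)" by (simp add: eq_neg_iff_add_eq_0)
    then have "x \<^sub>v* swap_mat n i j (- 1 / c) = x"
      using xc ij by (intro eq_vecI) (auto simp: vec_mult_swap_mat)
    then show "x \<^sub>v* swap_mat n i j (- 1 / c) \<in> C" using x by simp
  qed (use C' ij in auto)
  moreover have "swap_mat n i j (- 1 / c) \<notin> MAut0 n"
    using ij by (intro swap_mat_not_scalar) auto
  ultimately show ?thesis by blast
qed

section \<open>The main theorem\<close>

text \<open>As l / (l - 1) <= 2 and log n - log l >= 0 by \<open>n >= l\<close>, the factor may be
  raised to 2 and then \<open>l\<close> lowered to 2; exponentiating gives q^m <= (n / 2)^2 (q -
  1).\<close>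

lemma four_power_le_of_log_bound:
  fixes q l n m :: nat
  assumes q: "q \<ge> 2" and l: "l \<ge> 2" and n: "n \<ge> l"
    and m: "real m \<le> real l / (real l - 1) * log (real q) (real n) + log (real q) (real q - 1)
             - real l / (real l - 1) * log (real q) (real l)"
  shows "4 * q ^ m \<le> n\<^sup>2 * (q - 1)"
proof -
  define r where "r = real l / (real l - 1)"
  have r: "r \<le> 2" using l by (simp add: r_def divide_le_eq)
  have nonneg: "log q n - log q l \<ge> 0" using q l n by simp
  have "real m \<le> r * (log q n - log q l) + log q (real q - 1)"
    using m by (simp add: r_def algebra_simps)
  also have "\<dots> \<le> 2 * (log q n - log q l) + log q (real q - 1)"
    using mult_right_mono[OF r nonneg] by simp
  also have "\<dots> \<le> 2 * (log q n - log q 2) + log q (real q - 1)"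
    using q l by simp
  also have "\<dots> = log q ((real n / 2)\<^sup>2 * (real q - 1))"
    using q l n by (simp add: log_mult log_divide log_nat_power)
  finally have "real q powr real m \<le> (real n / 2)\<^sup>2 * (real q - 1)"
    using q l n by (subst (asm) le_log_iff) auto
  then have "4 * real q ^ m \<le> (real n)\<^sup>2 * (real q - 1)"
    using q by (simp add: powr_realpow power_divide)
  then have "real (4 * q ^ m) \<le> real (n\<^sup>2 * (q - 1))"
    using q by (simp add: of_nat_diff)
  then show ?thesis by (simp only: of_nat_le_iff)
qed

lemma half_codes_have_nonscalar_MAut:
  fixes n k :: nat
  defines "q \<equiv> CARD('a::{field,finite})"
  assumes n: "n \<ge> 3" and k: "k \<le> n" and bound: "4 * q ^ min k (n - k) \<le> n\<^sup>2 * (q - 1)"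
  shows "card (linear_codes n k :: 'a vec set set) \<le>
    2 * card {C \<in> linear_codes n k :: 'a vec set set. MAut n C \<noteq> MAut0 n}"
proof -
  let ?K = "\<lambda>k. linear_codes n k :: 'a vec set set" and ?S = "pair_vecs n :: 'a vec set"
  have fin: "finite {C \<in> ?K k. MAut n C \<noteq> MAut0 n}"
    using finite_linear_codes by (rule finite_subset[rotated]) auto
  show ?thesis
  proof (cases "n \<le> 2 * k")
    case True
    then have "min k (n - k) = n - k" by simp
    then have "card (?K k) \<le> 2 * card {C \<in> ?K k. \<exists>v\<in>?S. v \<in> C}"
      using bound unfolding q_def by (intro half_codes_meet_pair_vecs n k True) simp
    also have "card {C \<in> ?K k. \<exists>v\<in>?S. v \<in> C} \<le> card {C \<in> ?K k. MAut n C \<noteq> MAut0 n}"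
      using MAut_neq_MAut0_if_pair_vec fin
      by (intro card_mono) (auto simp: linear_codes_eq)
    finally show ?thesis by simp
  next
    case False
    \<comment> \<open>This is \<open>k\<close>, written as the codimension of the dual codes, whose
      dimension \<open>n - k\<close> is now at least half of \<open>n\<close>.\<close>
    then have min: "min k (n - k) = n - (n - k)" by simp
    let ?A = "{C \<in> ?K k. \<exists>v\<in>?S. v \<in> dual_code n C}"
    note bij = bij_betw_dual_linear_codes[OF k, where 'a='a]
    have "dual_code n ` ?A = {D \<in> ?K (n - k). \<exists>v\<in>?S. v \<in> D}"
      unfolding bij_betw_imp_surj_on[OF bij, symmetric] by blast
    moreover have "inj_on (dual_code n) ?A"
      using bij_betw_imp_inj_on[OF bij] by (rule inj_on_subset) blast
    ultimately have "bij_betw (dual_code n) ?A {D \<in> ?K (n - k). \<exists>v\<in>?S. v \<in> D}"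
      by (simp only: bij_betw_def)
    then have card_A: "card ?A = card {D \<in> ?K (n - k). \<exists>v\<in>?S. v \<in> D}"
      by (rule bij_betw_same_card)
    have "card (?K k) = card (?K (n - k))"
      using bij by (rule bij_betw_same_card)
    also have "\<dots> \<le> 2 * card {D \<in> ?K (n - k). \<exists>v\<in>?S. v \<in> D}"
      using bound False n unfolding q_def min by (intro half_codes_meet_pair_vecs) simp_all
    also have "\<dots> = 2 * card ?A" by (simp add: card_A)
    also have "card ?A \<le> card {C \<in> ?K k. MAut n C \<noteq> MAut0 n}"
      using MAut_neq_MAut0_if_dual_pair_vec fin
      by (intro card_mono) (auto simp: linear_codes_eq)
    finally show ?thesis by simp
  qed
qed

theorem mainTheorem2:
  fixes q l :: nat and \<epsilon> :: real
  assumes "q = CARD('a::{field,finite})"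
    and "l \<ge> 2"
    and "\<epsilon> > 0"
  shows "\<exists>n\<^sub>0::nat. \<forall>n>n\<^sub>0. \<forall>k::nat. 1 \<le> k \<and> k \<le> n \<and>
           real (min k (n - k)) \<le>
             real l / (real l - 1) * log (real q) (real n) + log (real q) (real q - 1)
             - real l / (real l - 1) * log (real q) (real l) \<longrightarrow>
           measure_pmf.prob (random_code n k :: 'a vec set pmf) {C. MAut n C \<noteq> MAut0 n}
             \<ge> 1 / 2 - \<epsilon>"
proof (intro exI[of _ "l + 3"] allI impI, elim conjE)
  fix n k :: nat
  \<comment> \<open>The threshold \<open>l + 3\<close> secures both \<open>n >= l\<close> for the
    logarithmic estimate and \<open>n >= 3\<close> for the count of codes.\<close>
  assume n: "l + 3 < n" and k: "k \<le> n" and m: "real (min k (n - k)) \<le>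
             real l / (real l - 1) * log (real q) (real n) + log (real q) (real q - 1)
             - real l / (real l - 1) * log (real q) (real l)"
  let ?K = "linear_codes n k :: 'a vec set set" and ?E = "{C. MAut n C \<noteq> MAut0 n} :: 'a vec set set"
  have q: "q \<ge> 2" using assms(1) card_field_gt_1[where 'a='a] by simp
  have K: "?K \<noteq> {}" "finite ?K" using linear_codes_nonempty[OF k] finite_linear_codes by auto
  have "4 * q ^ min k (n - k) \<le> n\<^sup>2 * (q - 1)"
    using n by (intro four_power_le_of_log_bound[OF q assms(2) _ m]) simp
  then have "card ?K \<le> 2 * card {C \<in> ?K. MAut n C \<noteq> MAut0 n}"
    using n k unfolding assms(1) by (intro half_codes_have_nonscalar_MAut) simp_all
  moreover have "{C \<in> ?K. MAut n C \<noteq> MAut0 n} = ?K \<inter> ?E" by auto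
  ultimately have "real (card ?K) \<le> 2 * real (card (?K \<inter> ?E))" by simp
  moreover have "card ?K > 0" using K by (simp add: card_gt_0_iff)
  ultimately have "1 / 2 \<le> real (card (?K \<inter> ?E)) / real (card ?K)"
    by (simp add: field_simps)
  also have "\<dots> = measure_pmf.prob (random_code n k) ?E"
    using K by (simp add: random_code_def measure_pmf_of_set)
  finally show "1 / 2 - \<epsilon> \<le> measure_pmf.prob (random_code n k) ?E"
    using assms(3) by simp
qed

end
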